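(* For each $j\in\mathbb{N}$ let $\phi_j\colon[0,1]^2\to[0,\infty)$ be the continuous density of a copula in $\mathbb{R}^2$. Define $C_1(u_1)=u_1$ for $u_1\in[0,1]$ and, for every $k\in\mathbb{N}\setminus\{1\}$ and $u_1,\dots,u_k\in[0,1]$, $$C_k(u_1,\dots,u_k)=\int_0^{u_1}\cdots\int_0^{u_k}\phi_1(v_1,v_2)\,\phi_2(v_2,v_3)\cdots\phi_{k-1}(v_{k-1},v_k)\,dv_k\cdots dv_1.$$ Then $(C_k)_{k\in\mathbb{N}}$ is a consistent family of copulas.
   Context: $\mathbb{N}=\{1,2,\dots\}$. A copula in $\mathbb{R}^k$ is a cumulative distribution function $C_k\colon[0,1]^k\to[0,1]$ (i.e. the restriction to $[0,1]^k$ of the distribution function of a probability measure on $[0,1]^k$) with uniform marginals: $C_k(1,\dots,1,u_j,1,\dots,1)=u_j$ for all $u_j\in[0,1]$, $j\in\{1,\dots,k\}$. It has density $c_k$ if $c_k\colon[0,1]^k\to[0,\infty)$ is measurable and $C_k(u_1,\dots,u_k)=\int_0^{u_1}\cdots\int_0^{u_k}c_k(v_1,\dots,v_k)\,dv_k\cdots dv_1$ for all $u_1,\dots,u_k\in[0,1]$. A family $(C_k)_{k\in\mathbb{N}}$ of copulas $C_k$ in $\mathbb{R}^k$ is called consistent if for all $k\in\mathbb{N}$: $C_{k+1}(u_1,\dots,u_k,1)=C_k(u_1,\dots,u_k)$ for all $u_1,\dots,u_k\in[0,1]$. *)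

theory Defs
  imports "HOL-Probability.Probability"
begin

text \<open>
  Points of \<open>[0,1]^k\<close> are extensional functions on the index set \<open>{1..k}\<close>. A function on
  \<open>[0,1]^k\<close> is a HOL function on \<open>nat \<Rightarrow> real\<close> of which only the values on \<open>unit_cube k\<close> matter.
\<close>

definition unit_cube :: "nat \<Rightarrow> (nat \<Rightarrow> real) set" where
  "unit_cube k = {1..k} \<rightarrow>\<^sub>E {0..1}"

definition cube_borel :: "nat \<Rightarrow> (nat \<Rightarrow> real) measure" where
  "cube_borel k = Pi\<^sub>M {1..k} (\<lambda>_. restrict_space borel {0..1})"

definition copula :: "nat \<Rightarrow> ((nat \<Rightarrow> real) \<Rightarrow> real) \<Rightarrow> bool" where
  "copula k C \<longleftrightarrow>
     (\<exists>M. prob_space M \<and> sets M = sets (cube_borel k) \<and>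
          (\<forall>u\<in>unit_cube k. C u = measure M {v \<in> space M. \<forall>i\<in>{1..k}. v i \<le> u i})) \<and>
     (\<forall>j\<in>{1..k}. \<forall>t\<in>{0..1}. C (\<lambda>i\<in>{1..k}. if i = j then t else 1) = t)"

text \<open>
  \<open>iterated_nn_integral k u f\<close> is the iterated Lebesgue integral of \<open>f\<close> over \<open>v\<^sub>1 \<in> [0, u\<^sub>1]\<close> (outermost)
  to \<open>v\<^sub>k \<in> [0, u\<^sub>k]\<close> (innermost). The base point \<open>\<lambda>_. undefined\<close> is the only extensional
  function on the empty index set, so \<open>f\<close> is evaluated at extensional functions on \<open>{1..k}\<close> only.
\<close>

fun iterated_nn_integral ::
    "nat \<Rightarrow> (nat \<Rightarrow> real) \<Rightarrow> ((nat \<Rightarrow> real) \<Rightarrow> ennreal) \<Rightarrow> ennreal" where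
  "iterated_nn_integral 0 u f = f (\<lambda>_. undefined)"
| "iterated_nn_integral (Suc k) u f =
     iterated_nn_integral k u (\<lambda>v. \<integral>\<^sup>+ t\<in>{0..u (Suc k)}. f (v(Suc k := t)) \<partial>lborel)"

definition has_copula_density ::
    "nat \<Rightarrow> ((nat \<Rightarrow> real) \<Rightarrow> real) \<Rightarrow> ((nat \<Rightarrow> real) \<Rightarrow> real) \<Rightarrow> bool" where
  "has_copula_density k C c \<longleftrightarrow>
     copula k C \<and>
     c \<in> borel_measurable (cube_borel k) \<and> (\<forall>v\<in>unit_cube k. 0 \<le> c v) \<and>
     (\<forall>u\<in>unit_cube k. ennreal (C u) = iterated_nn_integral k u (\<lambda>v. ennreal (c v)))"

definition consistent_copula_family :: "(nat \<Rightarrow> (nat \<Rightarrow> real) \<Rightarrow> real) \<Rightarrow> bool" where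
  "consistent_copula_family C \<longleftrightarrow>
     (\<forall>k\<ge>1. copula k (C k)) \<and>
     (\<forall>k\<ge>1. \<forall>u\<in>unit_cube k. C (Suc k) (u(Suc k := 1)) = C k u)"

end

theory Submission
  imports Defs
begin

text \<open>
  By continuity, a copula density on the square has both marginals equal to 1 at every point, not
  merely almost everywhere. So the \<open>\<phi>\<^sub>j\<close> are transition densities of a Markov chain on \<open>[0,1]\<close> for which
  the uniform distribution is stationary, and \<open>C\<^sub>k\<close> is the distribution function of the first \<open>k\<close>
  states of the stationary chain: integrating out the last state yields consistency, and stationarity
  yields the uniform marginals.
\<close>

section \<open>The uniform distribution on the unit interval and its powers\<close>

text \<open>Restricting the space, instead of putting a density on the whole line, makes
  \<open>{0..1}\<close> the carrier, so the finite powers have the cube as carrier and the sets of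
  \<open>cube_borel\<close>.\<close>

definition unit_lborel :: "real measure" where
  "unit_lborel = restrict_space lborel {0..1}"

lemma space_unit_lborel [simp]: "space unit_lborel = {0..1}"
  by (simp add: unit_lborel_def space_restrict_space)

lemma sets_unit_lborel: "sets unit_lborel = sets (restrict_space borel {0..1})"
  unfolding unit_lborel_def by (rule sets_restrict_space_cong) simp

lemma prob_space_unit_lborel: "prob_space unit_lborel"
  unfolding unit_lborel_def by (rule prob_spaceI) (simp add: space_restrict_space emeasure_restrict_space)

lemma borel_measurable_unit_lborelI:
  "f \<in> borel_measurable borel \<Longrightarrow> f \<in> borel_measurable unit_lborel"
  unfolding unit_lborel_def by (intro measurable_restrict_space1) simp

text \<open>The carrier takes care of the lower limit 0; what remains is the indicator of
  \<open>{..s}\<close>, one side of a lower box.\<close>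

lemma nn_integral_unit_lborel:
  assumes "s \<le> 1"
  shows "(\<integral>\<^sup>+ t\<in>{0..s}. f t \<partial>lborel) = (\<integral>\<^sup>+ t. f t * indicator {..s} t \<partial>unit_lborel)"
  unfolding unit_lborel_def using assms
  by (subst nn_integral_restrict_space) (auto intro!: nn_integral_cong split: split_indicator)

lemma nn_integral_unit_lborel_1:
  "(\<integral>\<^sup>+ t\<in>{0..1}. f t \<partial>lborel) = (\<integral>\<^sup>+ t. f t \<partial>unit_lborel)"
  unfolding unit_lborel_def by (subst nn_integral_restrict_space) auto

abbreviation unit_PiM :: "nat \<Rightarrow> (nat \<Rightarrow> real) measure" where
  "unit_PiM k \<equiv> Pi\<^sub>M {1..k} (\<lambda>_. unit_lborel)"

lemma sets_unit_PiM: "sets (unit_PiM k) = sets (cube_borel k)"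
  unfolding cube_borel_def by (rule sets_PiM_cong) (simp_all add: sets_unit_lborel)

interpretation unit_lborel: prob_space unit_lborel
  by (rule prob_space_unit_lborel)

lemma measurable_unit_lborel_coord:
  "i \<in> I \<Longrightarrow> (\<lambda>v. v i) \<in> borel_measurable (Pi\<^sub>M I (\<lambda>_. unit_lborel))"
  by (rule measurable_compose[OF measurable_component_singleton]) (auto intro: borel_measurable_unit_lborelI)

lemma lower_box_measurable [measurable]:
  "Measurable.pred (unit_PiM k) (\<lambda>v. \<forall>i\<in>{1..k}. v i \<le> u i)"
proof -
  have "Measurable.pred (unit_PiM k) (\<lambda>v. v i \<le> u i)" if "i \<in> {1..k}" for i
    using measurable_unit_lborel_coord[OF that, measurable] by measurable
  then show ?thesis by (intro pred_intros_finite) auto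
qed

section \<open>Iterated integrals as integrals over the product measure\<close>

context prob_space
begin

text \<open>Tonelli with the last coordinate innermost, the order in which
  \<open>iterated_nn_integral\<close> recurses and in which a chain loses its last state.\<close>

lemma nn_integral_PiM_Suc:
  assumes "f \<in> borel_measurable (Pi\<^sub>M {1..Suc k} (\<lambda>_. M))"
  shows "(\<integral>\<^sup>+ v. f v \<partial>Pi\<^sub>M {1..Suc k} (\<lambda>_. M)) =
    (\<integral>\<^sup>+ v. \<integral>\<^sup>+ t. f (v(Suc k := t)) \<partial>M \<partial>Pi\<^sub>M {1..k} (\<lambda>_. M))"
proof -
  interpret product_sigma_finite "\<lambda>_::nat. M"
    by unfold_locales
  have *: "{1..Suc k} = insert (Suc k) {1..k}" by auto
  show ?thesis
    using assms unfolding * by (intro product_nn_integral_insert) auto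
qed

end

lemma measurable_PiM_Suc_update:
  "(\<lambda>(v, t). v(Suc k := t)) \<in> Pi\<^sub>M {1..k} M \<Otimes>\<^sub>M M (Suc k) \<rightarrow>\<^sub>M Pi\<^sub>M {1..Suc k} M"
proof -
  have *: "{1..Suc k} = insert (Suc k) {1..k}" by auto
  show ?thesis unfolding * by (rule measurable_add_dim)
qed

text \<open>Tonelli, one coordinate at a time: the innermost integral is a measurable function of
  the first \<open>k\<close> coordinates, to which the induction hypothesis applies; hence
  \<open>f\<close> is generalized.\<close>

lemma iterated_nn_integral_eq:
  assumes "f \<in> borel_measurable (unit_PiM k)" "\<And>i. i \<in> {1..k} \<Longrightarrow> u i \<le> 1"
  shows "iterated_nn_integral k u f =
    (\<integral>\<^sup>+ v. f v * indicator {v. \<forall>i\<in>{1..k}. v i \<le> u i} v \<partial>unit_PiM k)"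
  using assms
proof (induction k arbitrary: f)
  case 0
  \<comment> \<open>The empty product is the point mass at \<open>\<lambda>_. undefined\<close>, the
    base point of the recursion.\<close>
  then show ?case by (simp add: PiM_empty nn_integral_count_space_finite)
next
  case (Suc k)
  note f [measurable] = Suc.prems(1)
  note measurable_PiM_Suc_update[where M = "\<lambda>_. unit_lborel", measurable]
  define F where "F v = (\<integral>\<^sup>+ t. f (v(Suc k := t)) * indicator {..u (Suc k)} t \<partial>unit_lborel)" for v
  have [measurable]: "indicator {..u (Suc k)} \<in> borel_measurable unit_lborel"
    by (rule borel_measurable_unit_lborelI) simp
  have [measurable]: "(\<lambda>(v, t). f (v(Suc k := t))) \<in> borel_measurable (unit_PiM k \<Otimes>\<^sub>M unit_lborel)"
    using measurable_compose[OF measurable_PiM_Suc_update f] by (simp only: prod.case_distrib[of f])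
  have F: "F \<in> borel_measurable (unit_PiM k)"
    unfolding F_def by measurable
  have "iterated_nn_integral (Suc k) u f = iterated_nn_integral k u F"
    using Suc.prems(2) by (simp add: F_def[abs_def] nn_integral_unit_lborel)
  also have "\<dots> = (\<integral>\<^sup>+ v. F v * indicator {v. \<forall>i\<in>{1..k}. v i \<le> u i} v \<partial>unit_PiM k)"
    using F Suc.prems(2) by (intro Suc.IH) auto
  also have "\<dots> = (\<integral>\<^sup>+ v. \<integral>\<^sup>+ t. f (v(Suc k := t)) *
      indicator {v. \<forall>i\<in>{1..Suc k}. v i \<le> u i} (v(Suc k := t)) \<partial>unit_lborel \<partial>unit_PiM k)"
  proof (intro nn_integral_cong)
    fix v assume v: "v \<in> space (unit_PiM k)"
    have [measurable]: "(\<lambda>t. f (v(Suc k := t))) \<in> borel_measurable unit_lborel"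
      using v by measurable
    \<comment> \<open>The factor for the first \<open>k\<close> coordinates is constant in
      \<open>t\<close> and leaves the inner integral.\<close>
    have "indicator {v. \<forall>i\<in>{1..Suc k}. v i \<le> u i} (v(Suc k := t)) =
        indicator {..u (Suc k)} t * (indicator {v. \<forall>i\<in>{1..k}. v i \<le> u i} v :: ennreal)" for t
      by (auto simp: atLeastAtMostSuc_conv split: split_indicator)
    then show "F v * indicator {v. \<forall>i\<in>{1..k}. v i \<le> u i} v = (\<integral>\<^sup>+ t. f (v(Suc k := t)) *
        indicator {v. \<forall>i\<in>{1..Suc k}. v i \<le> u i} (v(Suc k := t)) \<partial>unit_lborel)"
      by (simp add: F_def mult.assoc[symmetric] nn_integral_multc)
  qed
  also have "\<dots> = (\<integral>\<^sup>+ v. f v * indicator {v. \<forall>i\<in>{1..Suc k}. v i \<le> u i} v \<partial>unit_PiM (Suc k))"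
    by (intro unit_lborel.nn_integral_PiM_Suc[symmetric] borel_measurable_times_ennreal
        borel_measurable_indicator' f) measurable
  finally show ?case .
qed

section \<open>Markov chains with a stationary law\<close>

text \<open>\<open>kernel_out\<close> makes each \<open>K j\<close> a transition density and
  \<open>kernel_in\<close> makes \<open>M\<close> stationary for it. Both hold at every point, so no
  null sets have to be tracked.\<close>

locale doubly_stochastic_kernels = prob_space M for M :: "'a measure" +
  fixes K :: "nat \<Rightarrow> 'a \<Rightarrow> 'a \<Rightarrow> ennreal"
  assumes kernel_measurable: "\<And>j. j \<ge> 1 \<Longrightarrow> (\<lambda>(x, y). K j x y) \<in> borel_measurable (M \<Otimes>\<^sub>M M)"
    and kernel_out: "\<And>j x. j \<ge> 1 \<Longrightarrow> x \<in> space M \<Longrightarrow> (\<integral>\<^sup>+ y. K j x y \<partial>M) = 1"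
    and kernel_in: "\<And>j y. j \<ge> 1 \<Longrightarrow> y \<in> space M \<Longrightarrow> (\<integral>\<^sup>+ x. K j x y \<partial>M) = 1"
begin

abbreviation product_measure :: "nat \<Rightarrow> (nat \<Rightarrow> 'a) measure" where
  "product_measure k \<equiv> Pi\<^sub>M {1..k} (\<lambda>_. M)"

text \<open>The joint density of the states 1 to \<open>k\<close> of the chain started in
  \<open>M\<close>. At \<open>k = 1\<close> the product is empty and the density is 1.\<close>

definition path_density :: "nat \<Rightarrow> (nat \<Rightarrow> 'a) \<Rightarrow> ennreal" where
  "path_density k v = (\<Prod>j = 1..<k. K j (v j) (v (Suc j)))"

lemma path_density_measurable [measurable]:
  "path_density k \<in> borel_measurable (product_measure k)"
  unfolding path_density_def
proof (intro borel_measurable_prod_ennreal)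
  fix j assume j: "j \<in> {1..<k}"
  then have "(\<lambda>v. (v j, v (Suc j))) \<in> product_measure k \<rightarrow>\<^sub>M M \<Otimes>\<^sub>M M"
    by (intro measurable_Pair measurable_component_singleton) auto
  from measurable_compose[OF this kernel_measurable[of j]] j
  show "(\<lambda>v. K j (v j) (v (Suc j))) \<in> borel_measurable (product_measure k)"
    by simp
qed

lemma path_density_Suc_upd:
  assumes "k \<ge> 1"
  shows "path_density (Suc k) (v(Suc k := t)) = path_density k v * K k (v k) t"
  using assms by (simp add: path_density_def prod.atLeastLessThan_Suc)

text \<open>Given the first \<open>k\<close> states, the next one has density
  \<open>K k (v k)\<close>. Taking \<open>h = 1\<close> drops the last state; taking
  \<open>g = 1\<close> looks at the last state only.\<close>

lemma nn_integral_path_density_Suc: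
  assumes "k \<ge> 1" and g: "g \<in> borel_measurable (product_measure k)"
    and h: "h \<in> borel_measurable M"
  shows "(\<integral>\<^sup>+ v. path_density (Suc k) v * (g (restrict v {1..k}) * h (v (Suc k))) \<partial>product_measure (Suc k)) =
    (\<integral>\<^sup>+ v. path_density k v * (g v * (\<integral>\<^sup>+ t. K k (v k) t * h t \<partial>M)) \<partial>product_measure k)"
proof -
  note g [measurable] and h [measurable] and kernel_measurable[OF assms(1), measurable]
  have [measurable]: "(\<lambda>v. restrict v {1..k}) \<in> product_measure (Suc k) \<rightarrow>\<^sub>M product_measure k"
    by (rule measurable_restrict_subset) auto
  have [measurable]: "(\<lambda>v. v (Suc k)) \<in> product_measure (Suc k) \<rightarrow>\<^sub>M M"
    by (rule measurable_component_singleton) auto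
  have "(\<integral>\<^sup>+ v. path_density (Suc k) v * (g (restrict v {1..k}) * h (v (Suc k))) \<partial>product_measure (Suc k)) =
    (\<integral>\<^sup>+ v. \<integral>\<^sup>+ t. path_density (Suc k) (v(Suc k := t)) *
      (g (restrict (v(Suc k := t)) {1..k}) * h ((v(Suc k := t)) (Suc k))) \<partial>M \<partial>product_measure k)"
    by (rule nn_integral_PiM_Suc) measurable
  also have "\<dots> = (\<integral>\<^sup>+ v. path_density k v * (g v * (\<integral>\<^sup>+ t. K k (v k) t * h t \<partial>M)) \<partial>product_measure k)"
  proof (intro nn_integral_cong)
    fix v assume v: "v \<in> space (product_measure k)"
    \<comment> \<open>Points of the product are extensional, so restriction undoes the update
      exactly.\<close>
    have [simp]: "restrict (v(Suc k := t)) {1..k} = v" for t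
      using v by (auto simp: space_PiM PiE_def extensional_def restrict_def fun_eq_iff)
    have vk: "v k \<in> space M"
      using v assms(1) by (auto simp: space_PiM)
    have [measurable]: "K k (v k) \<in> borel_measurable M"
      using measurable_compose[OF measurable_Pair1'[OF vk] kernel_measurable[OF assms(1)]] by simp
    have "(\<integral>\<^sup>+ t. path_density (Suc k) (v(Suc k := t)) *
          (g (restrict (v(Suc k := t)) {1..k}) * h ((v(Suc k := t)) (Suc k))) \<partial>M) =
        (\<integral>\<^sup>+ t. path_density k v * g v * (K k (v k) t * h t) \<partial>M)"
      by (simp add: path_density_Suc_upd assms(1) ac_simps del: One_nat_def)
    also have "\<dots> = path_density k v * (g v * (\<integral>\<^sup>+ t. K k (v k) t * h t \<partial>M))"
      by (simp add: nn_integral_cmult mult.assoc)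
    finally show "(\<integral>\<^sup>+ t. path_density (Suc k) (v(Suc k := t)) *
          (g (restrict (v(Suc k := t)) {1..k}) * h ((v(Suc k := t)) (Suc k))) \<partial>M) =
        path_density k v * (g v * (\<integral>\<^sup>+ t. K k (v k) t * h t \<partial>M))" .
  qed
  finally show ?thesis .
qed

text \<open>The last state integrates to 1 by \<open>kernel_out\<close>. With the indicator of a
  lower box as \<open>g\<close>, this becomes consistency of the copulas.\<close>

lemma nn_integral_path_density_marginal:
  assumes "k \<ge> 1" and g: "g \<in> borel_measurable (product_measure k)"
  shows "(\<integral>\<^sup>+ v. path_density (Suc k) v * g (restrict v {1..k}) \<partial>product_measure (Suc k)) =
    (\<integral>\<^sup>+ v. path_density k v * g v \<partial>product_measure k)"
proof -
  have "(\<integral>\<^sup>+ v. path_density (Suc k) v * g (restrict v {1..k}) \<partial>product_measure (Suc k)) =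
    (\<integral>\<^sup>+ v. path_density k v * (g v * (\<integral>\<^sup>+ t. K k (v k) t \<partial>M)) \<partial>product_measure k)"
    using nn_integral_path_density_Suc[OF assms, of "\<lambda>_. 1"] by simp
  also have "\<dots> = (\<integral>\<^sup>+ v. path_density k v * g v \<partial>product_measure k)"
  proof (intro nn_integral_cong)
    fix v assume "v \<in> space (product_measure k)"
    then have "v k \<in> space M"
      using assms(1) by (auto simp: space_PiM)
    then show "path_density k v * (g v * (\<integral>\<^sup>+ t. K k (v k) t \<partial>M)) = path_density k v * g v"
      by (simp add: kernel_out[OF assms(1)])
  qed
  finally show ?thesis .
qed

text \<open>Stationarity, by induction on the length of the chain: an earlier coordinate survives
  dropping the last state, and the last coordinate is traced back one step, where
  \<open>kernel_in\<close> applies.\<close>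

lemma nn_integral_path_density_coord:
  assumes "1 \<le> j" "j \<le> k" and g: "g \<in> borel_measurable M"
  shows "(\<integral>\<^sup>+ v. path_density k v * g (v j) \<partial>product_measure k) = (\<integral>\<^sup>+ t. g t \<partial>M)"
proof -
  have "k \<ge> 1" using assms by simp
  then show ?thesis using assms
  \<comment> \<open>The last-coordinate case uses the induction hypothesis at index \<open>k\<close>
    and for a new function, so \<open>j\<close> and \<open>g\<close> both vary.\<close>
  proof (induction k arbitrary: j g rule: nat_induct_at_least)
    case base
    interpret product_sigma_finite "\<lambda>_::nat. M" ..
    from base show ?case
      by (simp add: path_density_def product_nn_integral_singleton)
  next
    case (Suc k)
    note g [measurable] = \<open>g \<in> borel_measurable M\<close> and [measurable] = kernel_measurable[OF Suc.hyps]
    show ?case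
    proof (cases "j = Suc k")
      case True
      \<comment> \<open>The conditional expectation of \<open>g\<close> at state
        \<open>Suc k\<close>, given that state \<open>k\<close> is \<open>x\<close>.\<close>
      define h where "h x = (\<integral>\<^sup>+ t. K k x t * g t \<partial>M)" for x
      have [measurable]: "h \<in> borel_measurable M"
        unfolding h_def by measurable
      have "(\<integral>\<^sup>+ v. path_density (Suc k) v * g (v j) \<partial>product_measure (Suc k)) =
          (\<integral>\<^sup>+ v. path_density k v * h (v k) \<partial>product_measure k)"
        using nn_integral_path_density_Suc[OF Suc.hyps _ g, of "\<lambda>_. 1"] True by (simp add: h_def)
      also have "\<dots> = (\<integral>\<^sup>+ x. h x \<partial>M)"
        using Suc.hyps by (intro Suc.IH) auto
      \<comment> \<open>The swap puts the integral over the first argument of the kernel inside,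
        ready for \<open>kernel_in\<close>.\<close>
      also have "\<dots> = (\<integral>\<^sup>+ t. \<integral>\<^sup>+ x. K k x t * g t \<partial>M \<partial>M)"
      proof -
        interpret pair_sigma_finite M M ..
        show ?thesis unfolding h_def by (rule Fubini'[symmetric]) measurable
      qed
      also have "\<dots> = (\<integral>\<^sup>+ t. g t \<partial>M)"
        using Suc.hyps by (intro nn_integral_cong) (simp add: nn_integral_multc kernel_in)
      finally show ?thesis .
    next
      case False
      then have j: "1 \<le> j" "j \<le> k" using Suc.prems by auto
      have [measurable]: "(\<lambda>v. g (v j)) \<in> borel_measurable (product_measure k)"
        using j by (intro measurable_compose[OF _ g] measurable_component_singleton) auto
      from nn_integral_path_density_marginal[OF Suc.hyps this] j Suc.IH[OF j g]
      show ?thesis by simp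
    qed
  qed
qed

end

section \<open>Marginals of continuous copula densities, at every point\<close>

text \<open>Differentiate \<open>int\<close> in \<open>s\<close>: by continuity of \<open>g\<close>,
  the fundamental theorem of calculus gives the derivative \<open>g x\<close> on the left, against 1
  on the right.\<close>

lemma continuous_density_eq_1:
  fixes g :: "real \<Rightarrow> real"
  assumes cont: "continuous_on {0..1} g" and nonneg: "\<And>x. x \<in> {0..1} \<Longrightarrow> 0 \<le> g x"
    and int: "\<And>s. s \<in> {0..1} \<Longrightarrow> (\<integral>\<^sup>+ x\<in>{0..s}. ennreal (g x) \<partial>lborel) = ennreal s"
    and x: "x \<in> {0..1}"
  shows "g x = 1"
proof -
  have eq: "integral {0..s} g = s" if s: "s \<in> {0..1}" for s
  proof -
    have c: "continuous_on {0..s} g"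
      using s by (intro continuous_on_subset[OF cont]) auto
    then have i: "(g has_integral integral {0..s} g) {0..s}"
      by (intro integrable_integral integrable_continuous_real)
    have "(\<integral>\<^sup>+ x. ennreal (indicator {0..s} x * g x) \<partial>lborel) = ennreal (integral {0..s} g)"
      using s by (intro nn_integral_has_integral_lebesgue i nonneg) auto
    also have "(\<integral>\<^sup>+ x. ennreal (indicator {0..s} x * g x) \<partial>lborel) =
        (\<integral>\<^sup>+ x\<in>{0..s}. ennreal (g x) \<partial>lborel)"
      by (auto intro!: nn_integral_cong split: split_indicator)
    also note int[OF s]
    finally show ?thesis
      using s nonneg by (subst (asm) ennreal_inj) (auto intro!: integral_nonneg integrable_continuous_real c)
  qed
  \<comment> \<open>Derivatives within \<open>{0..1}\<close> are one-sided at 0 and 1, so the end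
    points are covered too.\<close>
  have "((\<lambda>s. integral {0..s} g) has_vector_derivative g x) (at x within {0..1})"
    using cont x by (rule integral_has_vector_derivative)
  then have "((\<lambda>s. s) has_vector_derivative g x) (at x within {0..1})"
    by (rule has_vector_derivative_transform[OF x, rotated]) (simp add: eq)
  moreover have "((\<lambda>s. s) has_vector_derivative 1) (at x within {0..1})"
    by (rule has_vector_derivative_id)
  ultimately show ?thesis
    using vector_derivative_unique_within_closed_interval[of 0 1 x "\<lambda>s. s" "g x" 1] x by auto
qed

text \<open>Continuity is known on the square only, so the map is factored through the Borel space
  restricted to the square.\<close>

lemma measurable_continuous_on_unit_square:
  fixes f :: "real \<Rightarrow> real \<Rightarrow> real"
  assumes "continuous_on ({0..1} \<times> {0..1}) (\<lambda>(x, y). f x y)"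
  shows "(\<lambda>(x, y). f x y) \<in> borel_measurable (unit_lborel \<Otimes>\<^sub>M unit_lborel)"
proof -
  have "(\<lambda>p. (fst p, snd p)) \<in> unit_lborel \<Otimes>\<^sub>M unit_lborel \<rightarrow>\<^sub>M (borel \<Otimes>\<^sub>M borel :: (real \<times> real) measure)"
    by (intro measurable_Pair measurable_compose[OF measurable_fst] measurable_compose[OF measurable_snd]
        borel_measurable_unit_lborelI) auto
  then have "(\<lambda>p. p) \<in> unit_lborel \<Otimes>\<^sub>M unit_lborel \<rightarrow>\<^sub>M restrict_space borel ({0..1} \<times> {0..1 :: real})"
    by (intro measurable_restrict_space2) (auto simp: space_pair_measure borel_prod)
  from measurable_compose[OF this borel_measurable_continuous_on_restrict[OF assms]]
  show ?thesis .
qed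

lemma nn_integral_unit_lborel_continuous:
  fixes f :: "real \<Rightarrow> real"
  assumes "continuous_on {0..1} f" "\<And>x. x \<in> {0..1} \<Longrightarrow> 0 \<le> f x"
  shows "(\<integral>\<^sup>+ x. ennreal (f x) \<partial>unit_lborel) = ennreal (integral {0..1} f)"
proof -
  have "(f has_integral integral {0..1} f) {0..1}"
    by (intro integrable_integral integrable_continuous_real assms)
  then have "(\<integral>\<^sup>+ x. ennreal (indicator {0..1} x * f x) \<partial>lborel) = ennreal (integral {0..1} f)"
    by (intro nn_integral_has_integral_lebesgue assms)
  moreover have "(\<integral>\<^sup>+ x. ennreal (indicator {0..1} x * f x) \<partial>lborel) =
      (\<integral>\<^sup>+ x\<in>{0..1}. ennreal (f x) \<partial>lborel)"
    by (auto intro!: nn_integral_cong split: split_indicator)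
  ultimately show ?thesis
    by (simp add: nn_integral_unit_lborel_1)
qed

text \<open>The inner integral depends continuously on \<open>x\<close>, being a parameter integral
  of a function continuous on a compact square, so \<open>continuous_density_eq_1\<close> applies to
  it.\<close>

lemma continuous_kernel_integral_eq_1:
  fixes f :: "real \<Rightarrow> real \<Rightarrow> real"
  assumes cont: "continuous_on ({0..1} \<times> {0..1}) (\<lambda>(x, y). f x y)"
    and nonneg: "\<And>x y. x \<in> {0..1} \<Longrightarrow> y \<in> {0..1} \<Longrightarrow> 0 \<le> f x y"
    and int: "\<And>s. s \<in> {0..1} \<Longrightarrow>
      (\<integral>\<^sup>+ x\<in>{0..s}. (\<integral>\<^sup>+ y. ennreal (f x y) \<partial>unit_lborel) \<partial>lborel) = ennreal s"
    and x: "x \<in> {0..1}"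
  shows "(\<integral>\<^sup>+ y. ennreal (f x y) \<partial>unit_lborel) = 1"
proof -
  define g where "g x = integral {0..1} (f x)" for x
  have sec: "continuous_on {0..1} (f x)" if "x \<in> {0..1}" for x
  proof -
    have "continuous_on {0..1} (\<lambda>y. case (x, y) of (x, y) \<Rightarrow> f x y)"
      by (rule continuous_on_compose2[OF cont]) (use that in \<open>auto intro!: continuous_intros\<close>)
    then show ?thesis by simp
  qed
  have g: "(\<integral>\<^sup>+ y. ennreal (f x y) \<partial>unit_lborel) = ennreal (g x)" if "x \<in> {0..1}" for x
    unfolding g_def using that by (intro nn_integral_unit_lborel_continuous sec nonneg)
  have "g x = 1"
  proof (rule continuous_density_eq_1[OF _ _ _ x])
    show "continuous_on {0..1} g"
      using integral_continuous_on_param[of "{0..1}" 0 1 f] cont by (simp add: g_def[abs_def])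
    show "0 \<le> g x" if "x \<in> {0..1}" for x
      unfolding g_def using that by (intro integral_nonneg integrable_continuous_real sec nonneg)
    show "(\<integral>\<^sup>+ x\<in>{0..s}. ennreal (g x) \<partial>lborel) = ennreal s" if s: "s \<in> {0..1}" for s
      unfolding int[OF s, symmetric] using s
      by (intro nn_integral_cong) (auto simp: g split: split_indicator)
  qed
  then show ?thesis using g[OF x] by simp
qed

text \<open>Setting one argument of the copula to 1 turns its uniform marginals into the integral
  hypothesis of \<open>continuous_kernel_integral_eq_1\<close>, for \<open>f\<close> and for
  \<open>f\<close> with its arguments exchanged.\<close>

lemma continuous_copula_density_2:
  fixes f :: "real \<Rightarrow> real \<Rightarrow> real"
  assumes cont: "continuous_on ({0..1} \<times> {0..1}) (\<lambda>(x, y). f x y)"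
    and dens: "has_copula_density 2 D (\<lambda>v. f (v 1) (v 2))"
  shows continuous_copula_density_2_nonneg: "\<And>x y. x \<in> {0..1} \<Longrightarrow> y \<in> {0..1} \<Longrightarrow> 0 \<le> f x y"
    and continuous_copula_density_2_out: "\<And>x. x \<in> {0..1} \<Longrightarrow> (\<integral>\<^sup>+ y. ennreal (f x y) \<partial>unit_lborel) = 1"
    and continuous_copula_density_2_in: "\<And>y. y \<in> {0..1} \<Longrightarrow> (\<integral>\<^sup>+ x. ennreal (f x y) \<partial>unit_lborel) = 1"
proof -
  show nonneg: "0 \<le> f x y" if "x \<in> {0..1}" "y \<in> {0..1}" for x y
  proof -
    have "(\<lambda>i\<in>{1..2}. if i = 1 then x else y) \<in> unit_cube 2"
      using that by (auto simp: unit_cube_def)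
    then show ?thesis
      using dens unfolding has_copula_density_def by fastforce
  qed
  note f [measurable] = measurable_continuous_on_unit_square[OF cont]
  have marginal: "(\<integral>\<^sup>+ x\<in>{0..if j = 1 then s else 1}. (\<integral>\<^sup>+ y\<in>{0..if j = 2 then s else 1}.
      ennreal (f x y) \<partial>lborel) \<partial>lborel) = ennreal s"
    if "s \<in> {0..1}" "j \<in> {1, 2}" for s and j :: nat
  proof -
    let ?u = "\<lambda>i\<in>{1..2}. if i = j then s else 1 :: real"
    have "?u \<in> unit_cube 2" using that by (auto simp: unit_cube_def)
    then have "ennreal (D ?u) = iterated_nn_integral 2 ?u (\<lambda>v. ennreal (f (v 1) (v 2)))"
      using dens unfolding has_copula_density_def by blast
    moreover have "D ?u = s"
      using dens that unfolding has_copula_density_def copula_def by auto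
    ultimately show ?thesis
      using that by (auto simp: numeral_2_eq_2)
  qed
  show "(\<integral>\<^sup>+ y. ennreal (f x y) \<partial>unit_lborel) = 1" if "x \<in> {0..1}" for x
  proof (rule continuous_kernel_integral_eq_1[OF cont nonneg _ that])
    show "(\<integral>\<^sup>+ x\<in>{0..s}. (\<integral>\<^sup>+ y. ennreal (f x y) \<partial>unit_lborel) \<partial>lborel) = ennreal s"
      if "s \<in> {0..1}" for s
      using marginal[OF that, of 1] by (simp add: nn_integral_unit_lborel_1)
  qed
  show "(\<integral>\<^sup>+ x. ennreal (f x y) \<partial>unit_lborel) = 1" if "y \<in> {0..1}" for y
  proof (rule continuous_kernel_integral_eq_1[where f = "\<lambda>y x. f x y", OF _ nonneg _ that])
    have "continuous_on ({0..1} \<times> {0..1}) (\<lambda>p. case prod.swap p of (x, y) \<Rightarrow> f x y)"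
      by (rule continuous_on_compose2[OF cont continuous_on_swap]) auto
    then show "continuous_on ({0..1} \<times> {0..1}) (\<lambda>(y, x). f x y)"
      by (simp add: case_prod_unfold)
    show "(\<integral>\<^sup>+ y\<in>{0..s}. (\<integral>\<^sup>+ x. ennreal (f x y) \<partial>unit_lborel) \<partial>lborel) = ennreal s"
      if s: "s \<in> {0..1}" for s
    proof -
      interpret pair_sigma_finite unit_lborel unit_lborel ..
      have [measurable]: "indicator {..s} \<in> borel_measurable unit_lborel"
        by (rule borel_measurable_unit_lborelI) simp
      have "(\<integral>\<^sup>+ y\<in>{0..s}. (\<integral>\<^sup>+ x. ennreal (f x y) \<partial>unit_lborel) \<partial>lborel) =
          (\<integral>\<^sup>+ y. (\<integral>\<^sup>+ x. ennreal (f x y) \<partial>unit_lborel) * indicator {..s} y \<partial>unit_lborel)"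
        using s by (intro nn_integral_unit_lborel) auto
      also have "\<dots> = (\<integral>\<^sup>+ y. \<integral>\<^sup>+ x. ennreal (f x y) * indicator {..s} y \<partial>unit_lborel \<partial>unit_lborel)"
        by (intro nn_integral_cong nn_integral_multc[symmetric]) measurable
      \<comment> \<open>The copula is an iterated integral with \<open>x\<close> outermost, whereas
        this marginal has \<open>y\<close> outermost.\<close>
      also have "\<dots> = (\<integral>\<^sup>+ x. \<integral>\<^sup>+ y. ennreal (f x y) * indicator {..s} y \<partial>unit_lborel \<partial>unit_lborel)"
        by (rule Fubini') measurable
      also have "\<dots> = ennreal s"
        using marginal[OF s, of 2] s by (simp add: nn_integral_unit_lborel_1 nn_integral_unit_lborel)
      finally show ?thesis .
    qed
  qed auto
qed

section \<open>The copulas as distribution functions of the chain\<close>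

theorem lemma3p3:
  fixes \<phi> :: "nat \<Rightarrow> real \<Rightarrow> real \<Rightarrow> real"
    and C :: "nat \<Rightarrow> (nat \<Rightarrow> real) \<Rightarrow> real"
  assumes cont: "\<And>j. j \<ge> 1 \<Longrightarrow> continuous_on ({0..1} \<times> {0..1}) (\<lambda>(x, y). \<phi> j x y)"
    and dens: "\<And>j. j \<ge> 1 \<Longrightarrow> \<exists>D. has_copula_density 2 D (\<lambda>v. \<phi> j (v 1) (v 2))"
    and C1: "\<And>u. u \<in> unit_cube 1 \<Longrightarrow> C 1 u = u 1"
    and Ck: "\<And>k u. k \<ge> 2 \<Longrightarrow> u \<in> unit_cube k \<Longrightarrow>
      C k u = enn2real (iterated_nn_integral k u
        (\<lambda>v. ennreal (\<Prod>j = 1..<k. \<phi> j (v j) (v (Suc j)))))"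
  shows "consistent_copula_family C"
proof -
  interpret doubly_stochastic_kernels unit_lborel "\<lambda>j x y. ennreal (\<phi> j x y)"
  proof
    fix j :: nat assume j: "j \<ge> 1"
    then obtain D where D: "has_copula_density 2 D (\<lambda>v. \<phi> j (v 1) (v 2))"
      using dens by blast
    show "(\<lambda>(x, y). ennreal (\<phi> j x y)) \<in> borel_measurable (unit_lborel \<Otimes>\<^sub>M unit_lborel)"
      using measurable_continuous_on_unit_square[OF cont[OF j]] by measurable
    show "(\<integral>\<^sup>+ y. ennreal (\<phi> j x y) \<partial>unit_lborel) = 1" if "x \<in> space unit_lborel" for x
      using continuous_copula_density_2_out[OF cont[OF j] D] that by simp
    show "(\<integral>\<^sup>+ x. ennreal (\<phi> j x y) \<partial>unit_lborel) = 1" if "y \<in> space unit_lborel" for y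
      using continuous_copula_density_2_in[OF cont[OF j] D] that by simp
  qed
  \<comment> \<open>\<open>ennreal\<close> sends negative reals to 0 and is not multiplicative on
    them; nonnegativity lets it pass through the product of the \<phi> values.\<close>
  have phi_nonneg: "0 \<le> \<phi> j x y" if "j \<ge> 1" "x \<in> {0..1}" "y \<in> {0..1}" for j x y
    using dens continuous_copula_density_2_nonneg[OF cont] that by blast

  define box where "box k u = {v. \<forall>i\<in>{1..k}. v i \<le> u i}" for k and u :: "nat \<Rightarrow> real"
  have box_measurable [measurable]: "indicator (box k u) \<in> borel_measurable (unit_PiM k)"
    for k u unfolding box_def by (rule borel_measurable_indicator') measurable
  have total: "(\<integral>\<^sup>+ v. path_density k v \<partial>unit_PiM k) = 1" if "k \<ge> 1" for k
    using nn_integral_path_density_coord[of 1 k "\<lambda>_. 1"] that by (simp add: unit_lborel.emeasure_space_1[simplified])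
  \<comment> \<open>One formula for both defining equations: \<open>k = 1\<close> is the chain with
    a single uniform state, and larger \<open>k\<close> follow from Tonelli.\<close>
  have C_eq: "C k u = enn2real (\<integral>\<^sup>+ v. path_density k v * indicator (box k u) v \<partial>unit_PiM k)"
    if k: "k \<ge> 1" and u: "u \<in> unit_cube k" for k u
  proof (cases "k = 1")
    case True
    have u1: "u 1 \<in> {0..1}" using u k by (auto simp: unit_cube_def)
    have "(\<integral>\<^sup>+ v. path_density k v * indicator (box k u) v \<partial>unit_PiM k) =
        (\<integral>\<^sup>+ v. path_density k v * indicator {..u 1} (v 1) \<partial>unit_PiM k)"
      using True by (intro nn_integral_cong) (auto simp: box_def split: split_indicator)
    also have "\<dots> = (\<integral>\<^sup>+ t. 1 * indicator {..u 1} t \<partial>unit_lborel)"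
      using True by (subst nn_integral_path_density_coord) (auto intro: borel_measurable_unit_lborelI)
    also have "\<dots> = ennreal (u 1)"
      using u1 by (subst nn_integral_unit_lborel[symmetric]) auto
    finally show ?thesis using C1[of u] u u1 True by simp
  next
    case False
    let ?f = "\<lambda>v. ennreal (\<Prod>j = 1..<k. \<phi> j (v j) (v (Suc j)))"
    have f: "?f v = path_density k v" if "v \<in> space (unit_PiM k)" for v
      unfolding path_density_def using that
      by (intro prod_ennreal[symmetric] phi_nonneg) (auto simp: space_PiM)
    then have "?f \<in> borel_measurable (unit_PiM k)"
      by (subst measurable_cong[OF f]) measurable
    then have "iterated_nn_integral k u ?f = (\<integral>\<^sup>+ v. ?f v * indicator (box k u) v \<partial>unit_PiM k)"
      unfolding box_def using u by (intro iterated_nn_integral_eq) (auto simp: unit_cube_def)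
    also have "\<dots> = (\<integral>\<^sup>+ v. path_density k v * indicator (box k u) v \<partial>unit_PiM k)"
      by (intro nn_integral_cong) (simp only: f)
    finally show ?thesis using Ck[of k u] u k False by simp
  qed

  have "copula k (C k)" if k: "k \<ge> 1" for k
    unfolding copula_def
  proof (intro conjI exI ballI)
    \<comment> \<open>The witness is the law of the first \<open>k\<close> states.\<close>
    let ?M = "density (unit_PiM k) (path_density k)"
    show "prob_space ?M"
    proof
      have "emeasure ?M (space ?M) = (\<integral>\<^sup>+ v. path_density k v \<partial>unit_PiM k)"
        by (subst emeasure_density[OF path_density_measurable]) (auto intro!: nn_integral_cong split: split_indicator)
      then show "emeasure ?M (space ?M) = 1"
        using total[OF k] by simp
    qed
    show "sets ?M = sets (cube_borel k)"
      by (simp only: sets_density sets_unit_PiM)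
    show "C k u = measure ?M {v \<in> space ?M. \<forall>i\<in>{1..k}. v i \<le> u i}" if u: "u \<in> unit_cube k" for u
    proof -
      have "{v \<in> space ?M. \<forall>i\<in>{1..k}. v i \<le> u i} \<in> sets (unit_PiM k)"
        unfolding space_density by measurable
      note density = emeasure_density[OF path_density_measurable this]
      have "emeasure ?M {v \<in> space ?M. \<forall>i\<in>{1..k}. v i \<le> u i} =
          (\<integral>\<^sup>+ v. path_density k v * indicator (box k u) v \<partial>unit_PiM k)"
        unfolding density by (auto simp: box_def intro!: nn_integral_cong split: split_indicator)
      \<comment> \<open>\<open>measure\<close> is \<open>enn2real\<close> of
        \<open>emeasure\<close>, the same conversion as in \<open>C_eq\<close>.\<close>
      then show ?thesis by (simp add: C_eq[OF k u] measure_def)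
    qed
  next
    fix j t assume j: "j \<in> {1..k}" and t: "t \<in> {0..1::real}"
    let ?u = "\<lambda>i\<in>{1..k}. if i = j then t else 1 :: real"
    have u: "?u \<in> unit_cube k" using t by (auto simp: unit_cube_def)
    \<comment> \<open>On the cube the bounds 1 hold automatically, so the box constrains coordinate
      \<open>j\<close> alone and stationarity applies.\<close>
    have "(\<integral>\<^sup>+ v. path_density k v * indicator (box k ?u) v \<partial>unit_PiM k) =
        (\<integral>\<^sup>+ v. path_density k v * indicator {..t} (v j) \<partial>unit_PiM k)"
      using j by (intro nn_integral_cong) (auto simp: box_def space_PiM split: split_indicator)
    also have "\<dots> = (\<integral>\<^sup>+ s. 1 * indicator {..t} s \<partial>unit_lborel)"
      using j by (subst nn_integral_path_density_coord) (auto intro: borel_measurable_unit_lborelI)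
    also have "\<dots> = ennreal t"
      using t by (subst nn_integral_unit_lborel[symmetric]) auto
    finally show "C k ?u = t" unfolding C_eq[OF k u] using t by simp
  qed
  moreover have "C (Suc k) (u(Suc k := 1)) = C k u" if k: "k \<ge> 1" and u: "u \<in> unit_cube k" for k u
  proof -
    have u': "u(Suc k := 1) \<in> unit_cube (Suc k)"
      using u by (auto simp: unit_cube_def PiE_def extensional_def Pi_def)
    \<comment> \<open>Within the carrier, the larger box is the preimage of the smaller one under
      restriction, which is the shape that \<open>nn_integral_path_density_marginal\<close>
      expects.\<close>
    have "indicator (box (Suc k) (u(Suc k := 1))) v = (indicator (box k u) (restrict v {1..k}) :: ennreal)"
      if "v \<in> space (unit_PiM (Suc k))" for v
      using that by (auto simp: box_def space_PiM atLeastAtMostSuc_conv split: split_indicator)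
    then have "C (Suc k) (u(Suc k := 1)) = enn2real (\<integral>\<^sup>+ v. path_density (Suc k) v *
        indicator (box k u) (restrict v {1..k}) \<partial>unit_PiM (Suc k))"
      unfolding C_eq[OF le_SucI[OF k] u'] by (intro arg_cong[where f = enn2real] nn_integral_cong) (simp only:)
    also have "\<dots> = C k u"
      by (simp only: nn_integral_path_density_marginal[OF k box_measurable] C_eq[OF k u])
    finally show ?thesis .
  qed
  ultimately show ?thesis unfolding consistent_copula_family_def by blast
qed

end
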